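(* (a) Every triangle of area $1$ has an isosceles container whose area is smaller than $\sqrt{2}$. (b) Every non-isosceles triangle of area $1$ has a special container of the first kind whose area is smaller than $\frac{1+\sqrt{5}}{2}$. Both bounds are best possible: in (a), $\sqrt{2}$ cannot be replaced by any smaller constant, and in (b), $\frac{1+\sqrt5}{2}$ cannot be replaced by any smaller constant.
   Context: Triangles are non-degenerate closed triangular regions in the plane. An isosceles triangle is one with at least two sides of equal length. An isosceles container for a triangle $T$ is an isosceles triangle $T'$ with $T\subseteq T'$. $\vec{XY}$ denotes the ray starting at $X$ and passing through $Y$. Given a non-isosceles triangle, label its vertices $A,B,C$ so that $a=|BC|<b=|AC|<c=|AB|$. The special containers of the first kind associated with it are the isosceles triangles $AB'C$, $ABC'$, $ABC''$, where $B'$ is the point on the ray $\vec{CB}$ with $|B'C|=|AC|=b$; $C'$ is the point on the ray $\vec{AC}$ with $|AC'|=c$; $C''$ is the point on the ray $\vec{BC}$ with $|BC''|=c$. *)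

theory Defs
  imports "HOL-Analysis.Analysis"
begin

type_synonym point = "real ^ 2"

abbreviation area :: "point set \<Rightarrow> real" where
  "area T \<equiv> measure lborel T"

definition triangle_with_vertices :: "point set \<Rightarrow> point \<Rightarrow> point \<Rightarrow> point \<Rightarrow> bool" where
  "triangle_with_vertices T A B C \<longleftrightarrow> \<not> collinear {A, B, C} \<and> T = convex hull {A, B, C}"

definition is_triangle :: "point set \<Rightarrow> bool" where
  "is_triangle T \<longleftrightarrow> (\<exists>A B C. triangle_with_vertices T A B C)"

text \<open>The labelling of the vertices is existentially quantified, so it is no restriction
  that the two equal sides are the ones meeting at \<open>A\<close>.\<close>

definition isosceles :: "point set \<Rightarrow> bool" where
  "isosceles T \<longleftrightarrow> (\<exists>A B C. triangle_with_vertices T A B C \<and> dist A B = dist A C)"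

definition isosceles_container :: "point set \<Rightarrow> point set \<Rightarrow> bool" where
  "isosceles_container T T' \<longleftrightarrow> isosceles T' \<and> T \<subseteq> T'"

definition ray :: "point \<Rightarrow> point \<Rightarrow> point set" where
  "ray X Y = {X + t *\<^sub>R (Y - X) | t. 0 \<le> t}"

text \<open>For a non-isosceles triangle the three side lengths are distinct, so exactly one labelling
  \<open>A\<close>, \<open>B\<close>, \<open>C\<close> of its vertices satisfies the chain of inequalities below. The points \<open>B'\<close>,
  \<open>C'\<close>, \<open>C''\<close> are also uniquely determined, and the three disjuncts are the containers
  \<open>AB'C\<close>, \<open>ABC'\<close> and \<open>ABC''\<close>.\<close>

definition special_container_first_kind :: "point set \<Rightarrow> point set \<Rightarrow> bool" where
  "special_container_first_kind T T' \<longleftrightarrow>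
     (\<exists>A B C. triangle_with_vertices T A B C \<and>
        dist B C < dist A C \<and> dist A C < dist A B \<and>
        ((\<exists>B' \<in> ray C B. dist B' C = dist A C \<and> T' = convex hull {A, B', C}) \<or>
         (\<exists>C' \<in> ray A C. dist A C' = dist A B \<and> T' = convex hull {A, B, C'}) \<or>
         (\<exists>C'' \<in> ray B C. dist B C'' = dist A B \<and> T' = convex hull {A, B, C''})))"

end

theory Submission
  imports Defs
begin

text \<open>
  Let \<open>a \<le> b \<le> c\<close> be the side lengths of a triangle of area \<open>1\<close>. The containers \<open>AB'C\<close> and \<open>ABC'\<close>
  have areas \<open>b/a\<close> and \<open>c/b\<close>, and \<open>c < a + b\<close> prevents both from reaching the golden ratio \<open>\<phi>\<close>;
  nearly flat triangles with sides close to \<open>1, \<phi>, \<phi> + 1\<close> show that \<open>\<phi>\<close> is optimal.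

  For \<open>sqrt 2\<close>, reflecting \<open>A\<close> in the altitude from \<open>C\<close> gives \<open>D\<close> on the ray \<open>AB\<close>, and the isosceles
  triangle \<open>ACD\<close> has area \<open>1 + (b\<^sup>2 - a\<^sup>2) / c\<^sup>2\<close>. This is less than \<open>sqrt 2\<close> whenever \<open>c/b \<ge> sqrt 2\<close>.

  For optimality, take the triangles with vertices \<open>(0,0)\<close>, \<open>(1,0)\<close>, \<open>(1/sqrt 2, h)\<close> and stretch the
  vertical axis by \<open>1/h\<close>. The stretched containers have bounded area and contain a fixed triangle,
  hence their vertices stay bounded and, as \<open>h\<close> tends to \<open>0\<close>, a subsequence converges. In the limit
  only the horizontal parts of the two equal sides matter: either one side is vertical, or one
  vertex lies horizontally midway between the others. In both cases the area is at least
  \<open>sqrt 2\<close> times that of the fixed triangle.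
\<close>

section \<open>Signed areas and collinearity in coordinates\<close>

text \<open>Twice the signed area of the triangle. Being polynomial in the coordinates, it passes to
  limits of the vertices.\<close>

definition cross2 :: "point \<Rightarrow> point \<Rightarrow> point \<Rightarrow> real" where
  "cross2 A B C = (B$1 - A$1) * (C$2 - A$2) - (C$1 - A$1) * (B$2 - A$2)"

lemma area_triangle: "area (convex hull {A, B, C}) = \<bar>cross2 A B C\<bar> / 2"
  by (simp add: content_triangle cross2_def abs_minus_commute)

lemma collinear_iff_cross2: "collinear {A, B, C} \<longleftrightarrow> cross2 A B C = 0"
proof
  assume "collinear {A, B, C}"
  then consider "A = C" | u where "B = u *\<^sub>R A + (1 - u) *\<^sub>R C"
    by (auto simp: collinear_3_expand)
  then show "cross2 A B C = 0"
  proof cases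
    case 2
    show ?thesis
      unfolding 2 by (simp add: cross2_def algebra_simps)
  qed (simp add: cross2_def)
next
  assume 0: "cross2 A B C = 0"
  show "collinear {A, B, C}"
  proof (cases "A = C")
    case False
    define d where "d = (C$1 - A$1)\<^sup>2 + (C$2 - A$2)\<^sup>2"
    \<comment> \<open>\<open>v\<close> is the parameter of the orthogonal projection of
      \<open>B\<close> onto the line \<open>AC\<close>; a vanishing \<open>cross2\<close> makes
      \<open>B\<close> equal to its projection.\<close>
    define v where "v = ((B$1 - A$1) * (C$1 - A$1) + (B$2 - A$2) * (C$2 - A$2)) / d"
    have "d \<noteq> 0"
      using False by (auto simp: d_def vec_eq_iff forall_2 sum_power2_eq_zero_iff)
    have "(B$1 - A$1) * d = (C$1 - A$1) * (v * d)" "(B$2 - A$2) * d = (C$2 - A$2) * (v * d)"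
      using 0 \<open>d \<noteq> 0\<close> unfolding v_def cross2_def d_def
      by (simp_all, algebra+)
    then have "B$1 - A$1 = (C$1 - A$1) * v" "B$2 - A$2 = (C$2 - A$2) * v"
      using \<open>d \<noteq> 0\<close> by auto
    then have "B = (1 - v) *\<^sub>R A + (1 - (1 - v)) *\<^sub>R C"
      by (auto simp: vec_eq_iff forall_2 algebra_simps)
    then show ?thesis
      unfolding collinear_3_expand by blast
  qed (simp add: insert_commute)
qed

lemma collinear_iff_area_zero: "collinear {A, B, C} \<longleftrightarrow> area (convex hull {A, B, C}) = 0"
  by (simp add: area_triangle collinear_iff_cross2)

lemma cross2_mono:
  assumes "{X, Y, Z} \<subseteq> convex hull {P, Q, R}"
  shows "\<bar>cross2 X Y Z\<bar> \<le> \<bar>cross2 P Q R\<bar>"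
proof -
  have c: "compact (convex hull {P, Q, R})" "compact (convex hull {X, Y, Z})"
    by (simp_all add: compact_convex_hull)
  have "area (convex hull {X, Y, Z}) \<le> area (convex hull {P, Q, R})"
  proof (rule measure_mono_fmeasurable)
    show "convex hull {X, Y, Z} \<subseteq> convex hull {P, Q, R}"
      using assms by (simp add: hull_minimal)
    show "convex hull {P, Q, R} \<in> fmeasurable lborel"
      using c by (simp add: fmeasurable_compact)
    show "convex hull {X, Y, Z} \<in> sets lborel"
      using c by (simp add: borel_compact)
  qed
  then show ?thesis
    by (simp add: area_triangle)
qed

text \<open>The side on the line \<open>AC\<close> is scaled by \<open>r\<close> while the height of
  \<open>B\<close> over it stays the same.\<close>

lemma area_extend_side:
  assumes "0 \<le> r"
  shows "area (convex hull {A, B, A + r *\<^sub>R (C - A)}) = r * area (convex hull {A, B, C})"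
proof -
  have "cross2 A B (A + r *\<^sub>R (C - A)) = r * cross2 A B C"
    by (simp add: cross2_def algebra_simps)
  then show ?thesis
    using assms by (simp add: area_triangle abs_mult)
qed

lemma convex_hull_extend_side:
  fixes A B C :: point
  assumes "1 \<le> r"
  shows "convex hull {A, B, C} \<subseteq> convex hull {A, B, A + r *\<^sub>R (C - A)}"
proof (rule hull_minimal)
  have "C = (1 - 1/r) *\<^sub>R A + 0 *\<^sub>R B + (1/r) *\<^sub>R (A + r *\<^sub>R (C - A))"
    using assms by (simp add: algebra_simps)
  moreover have "0 \<le> 1 - 1/r" "0 \<le> 1/r"
    using assms by (auto simp: field_simps)
  ultimately have "C \<in> convex hull {A, B, A + r *\<^sub>R (C - A)}"
    unfolding convex_hull_3 by (intro CollectI exI conjI) (assumption | simp)+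
  then show "{A, B, C} \<subseteq> convex hull {A, B, A + r *\<^sub>R (C - A)}"
    by (simp add: hull_inc)
qed simp

section \<open>Vertices, side lengths and points on rays\<close>

text \<open>The vertices are the extreme points of the region. This lets the existentially
  quantified labellings in the definitions be compared with a known one.\<close>

lemma triangle_vertices_unique:
  assumes "triangle_with_vertices T A B C" "triangle_with_vertices T A' B' C'"
  shows "{A, B, C} = {A', B', C'}"
proof -
  have "{x. x extreme_point_of T} = {A, B, C}"
    if "triangle_with_vertices T A B C" for A B C
  proof -
    have "\<not> affine_dependent {A, B, C}" "T = convex hull {A, B, C}"
      using that by (auto simp: triangle_with_vertices_def collinear_3_eq_affine_dependent)
    then show ?thesis
      using extreme_point_of_convex_hull_affine_independent by blast
  qed
  then show ?thesis
    using assms by metis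
qed

lemma triangle_with_vertices_distinct:
  assumes "triangle_with_vertices T A B C"
  shows "A \<noteq> B" "A \<noteq> C" "B \<noteq> C"
  using assms by (auto simp: triangle_with_vertices_def collinear_3_eq_affine_dependent)

lemma triangle_with_vertices_permute:
  assumes "triangle_with_vertices T A B C"
  shows "triangle_with_vertices T B A C" "triangle_with_vertices T A C B"
  using assms by (simp_all add: triangle_with_vertices_def insert_commute)

lemma sorted_labelling:
  assumes "is_triangle T"
  obtains A B C where "triangle_with_vertices T A B C"
    "dist B C \<le> dist A C" "dist A C \<le> dist A B"
proof -
  obtain A B C where T: "triangle_with_vertices T A B C"
    using assms by (auto simp: is_triangle_def)
  have perms: "triangle_with_vertices T A B C" "triangle_with_vertices T A C B"
    "triangle_with_vertices T B A C" "triangle_with_vertices T B C A"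
    "triangle_with_vertices T C A B" "triangle_with_vertices T C B A"
    using T by (simp_all add: triangle_with_vertices_def insert_commute)
  show thesis
    using that[OF perms(1)] that[OF perms(2)] that[OF perms(3)]
      that[OF perms(4)] that[OF perms(5)] that[OF perms(6)]
    by (smt (verit) dist_commute)
qed

lemma triangle_strict_inequality:
  assumes "triangle_with_vertices T A B C"
  shows "dist A B < dist A C + dist B C"
proof -
  have "\<not> between (A, B) C"
    using assms between_imp_collinear[of A B C]
    by (auto simp: triangle_with_vertices_def insert_commute)
  then have "dist A B \<noteq> dist A C + dist C B"
    by (simp add: between)
  then show ?thesis
    using dist_triangle[of A B C] by (simp add: dist_commute)
qed

lemma dist_sq_plane: "(dist X Y)\<^sup>2 = (X$1 - Y$1)\<^sup>2 + (X$2 - Y$2)\<^sup>2" for X Y :: point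
  by (simp add: dist_norm norm_eq_sqrt_inner inner_vec_def sum_2 power2_eq_square)

lemma ray_point_eq:
  assumes "X' \<in> ray X Y" "X \<noteq> Y"
  shows "X' = X + (dist X X' / dist X Y) *\<^sub>R (Y - X)"
proof -
  obtain t where t: "X' = X + t *\<^sub>R (Y - X)" "0 \<le> t"
    using assms(1) by (auto simp: ray_def)
  then have "dist X X' = t * dist X Y"
    by (simp add: dist_norm norm_minus_commute)
  with t assms(2) show ?thesis
    by simp
qed

lemma area_ray_container:
  assumes "X' \<in> ray X Y" "X \<noteq> Y"
  shows "area (convex hull {X, Z, X'}) = dist X X' / dist X Y * area (convex hull {X, Y, Z})"
proof -
  have "area (convex hull {X, Z, X'}) = dist X X' / dist X Y * area (convex hull {X, Z, Y})"
    using area_extend_side[of "dist X X' / dist X Y" X Z Y] ray_point_eq[OF assms]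
    by simp
  then show ?thesis by (simp add: insert_commute)
qed

lemma ray_point_exists:
  assumes "X \<noteq> Y" "0 \<le> d"
  obtains X' where "X' \<in> ray X Y" "dist X X' = d"
proof
  show "X + (d / dist X Y) *\<^sub>R (Y - X) \<in> ray X Y"
    using assms by (auto simp: ray_def)
  show "dist X (X + (d / dist X Y) *\<^sub>R (Y - X)) = d"
    using assms by (simp add: dist_norm norm_minus_commute)
qed

section \<open>The upper bound sqrt 2\<close>

lemma isosceles_container_area_less_sqrt_2:
  assumes T: "is_triangle T" and area: "area T = 1"
  shows "\<exists>T'. isosceles_container T T' \<and> area T' < sqrt 2"
proof -
  obtain A B C where ABC: "triangle_with_vertices T A B C"
    and le: "dist B C \<le> dist A C" "dist A C \<le> dist A B"
    using sorted_labelling[OF T] .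
  define a b c where "a = dist B C" and "b = dist A C" and "c = dist A B"
  have pos: "0 < a" "0 < b" "0 < c" and ord: "a \<le> b" "b \<le> c" and tri: "c < b + a"
    using triangle_with_vertices_distinct[OF ABC] le triangle_strict_inequality[OF ABC]
    by (auto simp: a_def b_def c_def)
  have hull: "T = convex hull {A, B, C}"
    using ABC by (simp add: triangle_with_vertices_def)
  show ?thesis
  proof (cases "c < sqrt 2 * b")
    case True
    define C' where "C' = A + (c / b) *\<^sub>R (C - A)"
    have ar: "area (convex hull {A, B, C'}) = c / b"
      using area_extend_side[of "c / b" A B C] area hull pos by (simp add: C'_def)
    have "dist A B = dist A C'"
      using pos by (simp add: C'_def dist_norm norm_minus_commute c_def b_def)
    moreover have "\<not> collinear {A, B, C'}"
      using ar pos by (simp add: collinear_iff_area_zero)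
    ultimately have "isosceles (convex hull {A, B, C'})"
      by (auto simp: isosceles_def triangle_with_vertices_def)
    moreover have "T \<subseteq> convex hull {A, B, C'}"
      unfolding hull C'_def using ord pos by (intro convex_hull_extend_side) simp
    moreover have "c / b < sqrt 2"
      using True pos by (simp add: field_simps)
    ultimately show ?thesis
      unfolding isosceles_container_def using ar by metis
  next
    case False
    \<comment> \<open>By the law of cosines the reflection \<open>D\<close> of \<open>A\<close> in
      the altitude from \<open>C\<close> satisfies |AD| = 2 b cos A = (b^2 + c^2 - a^2) / c;
      \<open>r\<close> is |AD| / c.\<close>
    define r where "r = 1 + (b\<^sup>2 - a\<^sup>2) / c\<^sup>2"
    define D where "D = A + r *\<^sub>R (B - A)"
    have "1 \<le> r"
      using ord pos by (simp add: r_def)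
    have ar: "area (convex hull {A, C, D}) = r"
      using area_extend_side[of r A C B] area hull \<open>1 \<le> r\<close>
      by (simp add: D_def insert_commute)
    have nc: "\<not> collinear {C, A, D}"
      using ar \<open>1 \<le> r\<close> by (simp add: collinear_iff_area_zero insert_commute)
    have "(dist C D)\<^sup>2 - (dist C A)\<^sup>2 = r * (r * c\<^sup>2 - (b\<^sup>2 + c\<^sup>2 - a\<^sup>2))"
      unfolding a_def b_def c_def dist_sq_plane D_def
      by (simp add: algebra_simps power2_eq_square)
    also have "r * c\<^sup>2 = b\<^sup>2 + c\<^sup>2 - a\<^sup>2"
      using pos by (simp add: r_def field_simps)
    finally have "dist C A = dist C D"
      by simp
    moreover have "triangle_with_vertices (convex hull {A, C, D}) C A D"
      using nc by (simp add: triangle_with_vertices_def insert_commute)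
    ultimately have "isosceles (convex hull {A, C, D})"
      unfolding isosceles_def by blast
    moreover have "T \<subseteq> convex hull {A, C, D}"
      using convex_hull_extend_side[OF \<open>1 \<le> r\<close>, of A C B]
      by (simp add: hull D_def insert_commute)
    moreover have "r < sqrt 2"
    proof -
      \<comment> \<open>Here sqrt 2 * b <= c < a + b. Squaring, 1 - (sqrt 2 - 1)^2 = 2 * (sqrt 2 -
        1) bounds b^2 - a^2, and 2 * b^2 <= c^2 then compares it with c^2.\<close>
      have "(sqrt 2 - 1) * b < a"
        using False tri by (simp add: algebra_simps)
      then have "((sqrt 2 - 1) * b)\<^sup>2 < a\<^sup>2"
        using pos by (intro power_strict_mono) (auto)
      then have "b\<^sup>2 - a\<^sup>2 < (sqrt 2 - 1) * (2 * b\<^sup>2)"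
        by (simp add: power2_eq_square algebra_simps)
      also have "(sqrt 2 * b)\<^sup>2 \<le> c\<^sup>2"
        using False pos by (intro power_mono) auto
      then have "(sqrt 2 - 1) * (2 * b\<^sup>2) \<le> (sqrt 2 - 1) * c\<^sup>2"
        by (intro mult_left_mono) (auto simp: power_mult_distrib)
      finally show ?thesis
        using pos by (simp add: r_def field_simps)
    qed
    ultimately show ?thesis
      unfolding isosceles_container_def using ar by metis
  qed
qed

section \<open>The upper bound by the golden ratio\<close>

lemma golden_ratio_bounds: "1 < (1 + sqrt 5) / 2" "((1 + sqrt 5) / 2)\<^sup>2 = (1 + sqrt 5) / 2 + 1"
  by (simp_all add: power2_eq_square field_simps)

lemma special_container_area_less_golden_ratio:
  assumes T: "is_triangle T" and "\<not> isosceles T" and area: "area T = 1"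
  shows "\<exists>T'. special_container_first_kind T T' \<and> area T' < (1 + sqrt 5) / 2"
proof -
  obtain A B C where ABC: "triangle_with_vertices T A B C"
    and le: "dist B C \<le> dist A C" "dist A C \<le> dist A B"
    using sorted_labelling[OF T] .
  define a b c where "a = dist B C" and "b = dist A C" and "c = dist A B"
  define \<phi> :: real where "\<phi> = (1 + sqrt 5) / 2"
  note \<phi> = golden_ratio_bounds[folded \<phi>_def]
  have "dist B C \<noteq> dist A C" "dist A C \<noteq> dist A B"
    using assms(2) ABC triangle_with_vertices_permute[OF ABC]
      triangle_with_vertices_permute[OF triangle_with_vertices_permute(2)[OF ABC]]
    unfolding isosceles_def by (metis dist_commute)+
  then have ord: "dist B C < dist A C" "dist A C < dist A B"
    using le by auto
  have dst: "A \<noteq> B" "A \<noteq> C" "B \<noteq> C"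
    using triangle_with_vertices_distinct[OF ABC] .
  then have pos: "0 < a" "0 < b" "0 < c" and tri: "c < b + a"
    using triangle_strict_inequality[OF ABC] by (auto simp: a_def b_def c_def)
  have hull: "T = convex hull {A, B, C}"
    using ABC by (simp add: triangle_with_vertices_def)
  show ?thesis
  proof (cases "b / a < \<phi>")
    case True
    obtain B' where B': "B' \<in> ray C B" "dist C B' = b"
      using ray_point_exists[of C B b] dst pos by auto
    have "area (convex hull {A, B', C}) = b / a"
      using area_ray_container[OF B'(1), of A] B' dst area hull
      by (simp add: insert_commute a_def dist_commute)
    moreover have "special_container_first_kind T (convex hull {A, B', C})"
      unfolding special_container_first_kind_def
      using ABC ord B' by (metis b_def dist_commute)
    ultimately show ?thesis
      using True by (metis \<phi>_def)
  next
    case False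
    obtain C' where C': "C' \<in> ray A C" "dist A C' = c"
      using ray_point_exists[of A C c] dst pos by auto
    have "area (convex hull {A, B, C'}) = c / b"
      using area_ray_container[OF C'(1), of B] C' dst area hull
      by (simp add: insert_commute b_def dist_commute)
    moreover have "special_container_first_kind T (convex hull {A, B, C'})"
      unfolding special_container_first_kind_def
      using ABC ord C' by (metis c_def)
    moreover have "c / b < \<phi>"
    proof -
      \<comment> \<open>Since (\<phi> - 1) * \<phi> = 1, this turns into a <= (\<phi> - 1) * b,
        whence c < a + b <= \<phi> * b.\<close>
      have "\<phi> * a \<le> b"
        using False pos by (simp add: field_simps)
      then have "(\<phi> - 1) * (\<phi> * a) \<le> (\<phi> - 1) * b"
        using \<phi> by (intro mult_left_mono) auto
      moreover have "(\<phi> - 1) * (\<phi> * a) = (\<phi>\<^sup>2 - \<phi>) * a"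
        by (simp add: algebra_simps power2_eq_square)
      ultimately have "a \<le> (\<phi> - 1) * b"
        using \<phi> by simp
      then have "c < \<phi> * b"
        using tri by (simp add: algebra_simps)
      then show ?thesis
        using pos by (simp add: field_simps)
    qed
    ultimately show ?thesis
      by (metis \<phi>_def)
  qed
qed

section \<open>Optimality of the golden ratio\<close>

abbreviation pt :: "real \<Rightarrow> real \<Rightarrow> point" where
  "pt x y \<equiv> vector [x, y]"

text \<open>The strict order of the sides forces the labelling in the definition to be the given
  one. The three containers then have areas b/a, c/b and c/a, and c/a exceeds c/b.\<close>

lemma special_container_area_cases:
  assumes sp: "special_container_first_kind T T'" and T: "triangle_with_vertices T A B C"
    and ord: "dist B C < dist A C" "dist A C < dist A B" and area: "area T = 1"
  shows "dist A C / dist B C \<le> area T' \<or> dist A B / dist A C \<le> area T'"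
proof -
  obtain A' B' C' where T': "triangle_with_vertices T A' B' C'"
    and ord': "dist B' C' < dist A' C'" "dist A' C' < dist A' B'"
    and cont: "(\<exists>X \<in> ray C' B'. dist X C' = dist A' C' \<and> T' = convex hull {A', X, C'}) \<or>
         (\<exists>X \<in> ray A' C'. dist A' X = dist A' B' \<and> T' = convex hull {A', B', X}) \<or>
         (\<exists>X \<in> ray B' C'. dist B' X = dist A' B' \<and> T' = convex hull {A', B', X})"
    using sp unfolding special_container_first_kind_def by blast
  have "{A', B', C'} = {A, B, C}"
    using triangle_vertices_unique[OF T' T] .
  then have "A' \<in> {A, B, C}" "B' \<in> {A, B, C}" "C' \<in> {A, B, C}"
    by blast+
  with ord ord' have eq: "A' = A" "B' = B" "C' = C"
    by (auto simp: dist_commute)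
  have dst: "A \<noteq> B" "A \<noteq> C" "B \<noteq> C"
    using triangle_with_vertices_distinct[OF T] .
  have hull: "area (convex hull {A, B, C}) = 1"
    using T area by (simp add: triangle_with_vertices_def)
  consider X where "X \<in> ray C B" "dist X C = dist A C" "T' = convex hull {A, X, C}"
    | X where "X \<in> ray A C" "dist A X = dist A B" "T' = convex hull {A, B, X}"
    | X where "X \<in> ray B C" "dist B X = dist A B" "T' = convex hull {A, B, X}"
    using cont unfolding eq by blast
  then show ?thesis
  proof cases
    case 1
    then have "area T' = dist A C / dist B C"
      using area_ray_container[OF 1(1), of A] dst hull
      by (simp add: insert_commute dist_commute)
    then show ?thesis by simp
  next
    case 2
    then have "area T' = dist A B / dist A C"
      using area_ray_container[OF 2(1), of B] dst hull
      by (simp add: insert_commute dist_commute)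
    then show ?thesis by simp
  next
    case 3
    then have "area T' = dist A B / dist B C"
      using area_ray_container[OF 3(1), of A] dst hull
      by (simp add: insert_commute dist_commute)
    moreover have "dist A B / dist A C \<le> dist A B / dist B C"
      using ord dst by (intro divide_left_mono) auto
    ultimately show ?thesis by simp
  qed
qed

text \<open>The triangle is a copy, scaled by \<open>s\<close>, of the one with vertices (0,0),
  (\<phi>^2,0), (\<phi>,h). As \<phi>^2 - \<phi> = 1, it flattens to lengths 1, \<phi>, \<phi>^2, so
  both b/a and c/b tend to \<phi> as \<open>h\<close> tends to 0.\<close>

lemma golden_ratio_optimal:
  assumes "k < (1 + sqrt 5) / 2"
  shows "\<exists>T. is_triangle T \<and> \<not> isosceles T \<and> area T = 1 \<and>
    (\<forall>T'. special_container_first_kind T T' \<longrightarrow> k < area T')"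
proof -
  define \<phi> :: real where "\<phi> = (1 + sqrt 5) / 2"
  note \<phi> = golden_ratio_bounds[folded \<phi>_def]
  have "((\<lambda>h. sqrt (\<phi>\<^sup>2 + h\<^sup>2) / sqrt (1 + h\<^sup>2)) \<longlongrightarrow> sqrt (\<phi>\<^sup>2 + 0\<^sup>2) / sqrt (1 + 0\<^sup>2)) (at_right 0)"
    by (intro tendsto_intros) auto
  then have 1: "\<forall>\<^sub>F h in at_right 0. k < sqrt (\<phi>\<^sup>2 + h\<^sup>2) / sqrt (1 + h\<^sup>2)"
    using assms \<phi> by (intro order_tendstoD(1)) (auto simp: \<phi>_def)
  have "((\<lambda>h. \<phi>\<^sup>2 / sqrt (\<phi>\<^sup>2 + h\<^sup>2)) \<longlongrightarrow> \<phi>\<^sup>2 / sqrt (\<phi>\<^sup>2 + 0\<^sup>2)) (at_right 0)"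
    using \<phi> by (intro tendsto_intros) auto
  then have 2: "\<forall>\<^sub>F h in at_right 0. k < \<phi>\<^sup>2 / sqrt (\<phi>\<^sup>2 + h\<^sup>2)"
  proof (rule order_tendstoD(1))
    have "\<phi>\<^sup>2 / sqrt (\<phi>\<^sup>2 + 0\<^sup>2) = \<phi>"
      using \<phi>(1) by (simp add: power2_eq_square)
    then show "k < \<phi>\<^sup>2 / sqrt (\<phi>\<^sup>2 + 0\<^sup>2)"
      using assms by (simp add: \<phi>_def)
  qed
  have 3: "\<forall>\<^sub>F h in at_right 0. h \<in> {0<..<1::real}"
    by (rule eventually_at_rightI[of 0 1]) auto
  obtain h where h: "0 < h" "h < 1" "k < sqrt (\<phi>\<^sup>2 + h\<^sup>2) / sqrt (1 + h\<^sup>2)"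
    "k < \<phi>\<^sup>2 / sqrt (\<phi>\<^sup>2 + h\<^sup>2)"
    using eventually_happens[OF eventually_conj[OF 3 eventually_conj[OF 1 2]]]
    by (auto simp: trivial_limit_at_right_real)
  \<comment> \<open>Normalizes the area s^2 * \<phi>^2 * h / 2 to 1.\<close>
  define s where "s = sqrt (2 / (\<phi>\<^sup>2 * h))"
  have s: "0 < s" "s\<^sup>2 * (\<phi>\<^sup>2 * h) = 2"
    using h \<phi> by (auto simp: s_def)
  define A B C where "A = pt 0 0" and "B = pt (s * \<phi>\<^sup>2) 0" and "C = pt (s * \<phi>) (s * h)"
  define T where "T = convex hull {A, B, C}"
  have dist_eqI: "dist X Y = d" if "0 \<le> d" "(X$1 - Y$1)\<^sup>2 + (X$2 - Y$2)\<^sup>2 = d\<^sup>2" for X Y :: point and d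
    using that dist_sq_plane[of X Y] by (metis power2_eq_iff_nonneg zero_le_dist)
  have a: "dist B C = s * sqrt (1 + h\<^sup>2)"
    using s unfolding B_def C_def
    by (intro dist_eqI) (auto simp: \<phi>(2) power_mult_distrib algebra_simps)
  have b: "dist A C = s * sqrt (\<phi>\<^sup>2 + h\<^sup>2)"
    using s unfolding A_def C_def
    by (intro dist_eqI) (auto simp: power_mult_distrib algebra_simps)
  have c: "dist A B = s * \<phi>\<^sup>2"
    using s unfolding A_def B_def
    by (intro dist_eqI) (auto simp: power_mult_distrib algebra_simps)
  have "1 + h\<^sup>2 < \<phi>\<^sup>2 + h\<^sup>2"
    using \<phi> by simp
  then have ab: "dist B C < dist A C"
    unfolding a b using s by simp
  have "\<phi>\<^sup>2 + h\<^sup>2 < \<phi>\<^sup>2 + 1"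
    using h by (simp add: power_less_one_iff)
  also have "\<dots> < (\<phi>\<^sup>2)\<^sup>2"
    using \<phi> by (simp add: power2_eq_square algebra_simps)
  finally have bc: "dist A C < dist A B"
    unfolding b c using s by (simp add: real_less_lsqrt)
  have area: "area T = 1"
    using s h unfolding T_def area_triangle
    by (simp add: cross2_def A_def B_def C_def power2_eq_square ac_simps)
  then have tri: "triangle_with_vertices T A B C"
    by (auto simp: triangle_with_vertices_def collinear_iff_area_zero T_def)
  have "\<not> isosceles T"
  proof
    assume "isosceles T"
    then obtain A' B' C' where T': "triangle_with_vertices T A' B' C'" and eq: "dist A' B' = dist A' C'"
      by (auto simp: isosceles_def)
    have "{A', B', C'} = {A, B, C}"
      using triangle_vertices_unique[OF T' tri] .
    then have "A' \<in> {A, B, C}" "B' \<in> {A, B, C}" "C' \<in> {A, B, C}"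
      by blast+
    with eq ab bc triangle_with_vertices_distinct[OF T'] show False
      by (auto simp: dist_commute)
  qed
  moreover have "k < area T'" if "special_container_first_kind T T'" for T'
    using special_container_area_cases[OF that tri ab bc area] h s unfolding a b c by auto
  ultimately show ?thesis
    using tri area unfolding is_triangle_def by blast
qed

section \<open>Limits of containers and optimality of sqrt 2\<close>

text \<open>A line strictly separating \<open>x\<close> from the limit hull would also separate it
  from the hulls with large index.\<close>

lemma in_convex_hull_3_limit:
  fixes P Q R :: "nat \<Rightarrow> 'a::euclidean_space"
  assumes "P \<longlonglongrightarrow> p" "Q \<longlonglongrightarrow> q" "R \<longlonglongrightarrow> r" and mem: "\<And>n. x \<in> convex hull {P n, Q n, R n}"
  shows "x \<in> convex hull {p, q, r}"
proof (rule ccontr)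
  assume "x \<notin> convex hull {p, q, r}"
  then obtain a b where "inner a x < b" and sep: "\<forall>y\<in>convex hull {p, q, r}. b < inner a y"
    using separating_hyperplane_closed_point[of "convex hull {p, q, r}" x]
    by (auto simp: compact_convex_hull compact_imp_closed)
  have ev: "\<forall>\<^sub>F n in sequentially. b < inner a (U n)"
    if "U \<longlonglongrightarrow> u" "u \<in> {p, q, r}" for U u
    using that sep by (intro order_tendstoD(1)[OF tendsto_inner[OF tendsto_const that(1)]])
      (auto simp: hull_inc)
  have "\<forall>\<^sub>F n in sequentially. b < inner a (P n) \<and> b < inner a (Q n) \<and> b < inner a (R n)"
    using assms(1-3) by (intro eventually_conj ev) auto
  then obtain n where "b < inner a (P n)" "b < inner a (Q n)" "b < inner a (R n)"
    using eventually_happens[of _ sequentially] by auto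
  then have "convex hull {P n, Q n, R n} \<subseteq> {y. b < inner a y}"
    by (intro hull_minimal) (auto simp: convex_halfspace_gt)
  then show False
    using mem[of n] \<open>inner a x < b\<close> by auto
qed

text \<open>The vertical section of the container through \<open>(t, 0)\<close> has length at least \<open>1\<close>; comparing
  barycentric coordinates of its points \<open>(t, 0)\<close> and \<open>(t, 1)\<close> bounds the longest vertical section
  from below.\<close>

lemma limit_container_bound:
  fixes P Q R :: point
  defines "t \<equiv> 1 / sqrt 2 :: real"
  assumes sub: "{pt 0 0, pt 1 0, pt t 1} \<subseteq> convex hull {P, Q, R}"
    and iso: "(P$1 - Q$1)\<^sup>2 = (P$1 - R$1)\<^sup>2"
  shows "sqrt 2 \<le> \<bar>cross2 P Q R\<bar>"
proof -
  have t: "0 < t" "t < 1" "t * t = 1/2" "sqrt 2 * t = 1" "sqrt 2 = 2 * t" "1/2 < t"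
    by (auto simp: t_def field_simps real_less_lsqrt)
  define X where "X = pt t 0"
  have "X = (1 - t) *\<^sub>R pt 0 0 + t *\<^sub>R pt 1 0"
    by (simp add: X_def vec_eq_iff forall_2)
  then have X: "X \<in> convex hull {P, Q, R}"
    using sub t convexD[OF convex_convex_hull, of "pt 0 0" "{P, Q, R}" "pt 1 0" "1 - t" t] by auto
  have half: "convex {y::point. y$1 \<le> c}" "convex {y::point. y$1 \<ge> c}" for c
    using convex_halfspace_le[of "axis 1 1::point" c] convex_halfspace_ge[of c "axis 1 1::point"]
    by (simp_all add: inner_axis')
  \<comment> \<open>The container spans at least the interval [0, 1] horizontally, because it
    contains (0,0) and (1,0).\<close>
  have left: "c \<le> 0" if "c \<le> P$1" "c \<le> Q$1" "c \<le> R$1" for c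
    using hull_minimal[of "{P,Q,R}" "{y. y$1 \<ge> c}" convex] half that sub by auto
  have right: "1 \<le> c" if "P$1 \<le> c" "Q$1 \<le> c" "R$1 \<le> c" for c
    using hull_minimal[of "{P,Q,R}" "{y. y$1 \<le> c}" convex] half that sub by auto
  obtain u v w where uvw: "0 \<le> u" "0 \<le> v" "0 \<le> w" "u + v + w = 1"
    and X_eq: "X = u *\<^sub>R P + v *\<^sub>R Q + w *\<^sub>R R"
    using X unfolding convex_hull_3 by blast
  obtain u' v' w' where uvw': "0 \<le> u'" "0 \<le> v'" "0 \<le> w'" "u' + v' + w' = 1"
    and Y_eq: "pt t 1 = u' *\<^sub>R P + v' *\<^sub>R Q + w' *\<^sub>R R"
    using sub unfolding convex_hull_3 by blast
  have x: "u * P$1 + v * Q$1 + w * R$1 = t" "u' * P$1 + v' * Q$1 + w' * R$1 = t"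
    using arg_cong[OF X_eq, of "\<lambda>z. z$1"] arg_cong[OF Y_eq, of "\<lambda>z. z$1"] by (simp_all add: X_def)
  have y: "u * P$2 + v * Q$2 + w * R$2 = 0" "u' * P$2 + v' * Q$2 + w' * R$2 = 1"
    using arg_cong[OF X_eq, of "\<lambda>z. z$2"] arg_cong[OF Y_eq, of "\<lambda>z. z$2"] by (simp_all add: X_def)
  have P1: "u = 1 - v - w" "u' = 1 - v' - w'"
    using uvw uvw' by auto
  consider "Q$1 = R$1" | "Q$1 + R$1 = 2 * P$1"
    using iso unfolding power2_eq_iff by force
  then show ?thesis
  proof cases
    case 1
    define d where "d = P$1 - Q$1"
    have "d \<noteq> 0"
      using left[of "P$1"] right[of "P$1"] 1 by (auto simp: d_def)
    \<comment> \<open>With \<open>QR\<close> vertical, the abscissa alone determines the weight of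
      \<open>P\<close>, so both points have the same \<open>u\<close> and differ by a shift parallel
      to \<open>QR\<close>. The vertical section there has length (1 - u) * |QR|.\<close>
    have ud: "u * d = t - Q$1" "u' * d = t - Q$1"
      using x 1 unfolding P1 d_def by (auto simp: algebra_simps)
    then have uu: "u' = u"
      using \<open>d \<noteq> 0\<close> by (metis mult_right_cancel)
    have "(v' - v) * (Q$2 - R$2) = 1"
      using y uu P1 uvw uvw' by algebra
    then have prod: "\<bar>v' - v\<bar> * \<bar>Q$2 - R$2\<bar> = 1"
      by (simp flip: abs_mult)
    have "\<bar>v' - v\<bar> \<le> 1 - u"
      using uvw uvw' uu by auto
    then have "1 \<le> (1 - u) * \<bar>Q$2 - R$2\<bar>"
      using prod by (metis abs_ge_zero mult_right_mono)
    have cr: "\<bar>cross2 P Q R\<bar> = \<bar>d\<bar> * \<bar>Q$2 - R$2\<bar>"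
    proof -
      have "cross2 P Q R = d * (Q$2 - R$2)"
        using 1 by (simp add: cross2_def d_def algebra_simps)
      then show ?thesis by (simp add: abs_mult)
    qed
    \<comment> \<open>(1 - u) * |d| is the horizontal distance from \<open>P\<close> to the line x =
      t. The span of the container bounds |d| below by 1 - P$1 or by P$1, according to the side of
      \<open>QR\<close> on which \<open>P\<close> lies.\<close>
    have ineq: "sqrt 2 * ((1 - u) * \<bar>d\<bar>) \<le> \<bar>d\<bar>\<^sup>2"
    proof (cases "d < 0")
      case True
      have PQ: "P$1 \<le> 0" "1 \<le> Q$1"
        using left[of "P$1"] right[of "Q$1"] 1 True by (auto simp: d_def)
      have "sqrt 2 * ((1 - u) * \<bar>d\<bar>) = 1 - 2 * (t * P$1)"
        using ud(1) True t by (simp add: d_def algebra_simps)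
      also have "\<dots> \<le> 1 - 2 * P$1 + P$1 * P$1"
        using mult_right_mono_neg[of t 1 "P$1"] PQ t zero_le_square[of "P$1"] by linarith
      also have "\<dots> = (1 - P$1)\<^sup>2"
        by (simp add: power2_eq_square algebra_simps)
      also have "\<dots> \<le> \<bar>d\<bar>\<^sup>2"
        using PQ by (intro power_mono) (auto simp: d_def)
      finally show ?thesis .
    next
      case False
      have PQ: "Q$1 \<le> 0" "1 \<le> P$1"
        using left[of "Q$1"] right[of "P$1"] 1 False by (auto simp: d_def)
      have "sqrt 2 * ((1 - u) * \<bar>d\<bar>) = 2 * (t * P$1) - 1"
        using ud(1) False t by (simp add: d_def algebra_simps)
      also have "\<dots> \<le> (P$1)\<^sup>2"
        using zero_le_power2[of "P$1 - t"] t by (simp add: power2_eq_square algebra_simps)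
      also have "\<dots> \<le> \<bar>d\<bar>\<^sup>2"
        using PQ by (intro power_mono) (auto simp: d_def)
      finally show ?thesis .
    qed
    have "sqrt 2 * \<bar>d\<bar> * 1 \<le> sqrt 2 * \<bar>d\<bar> * ((1 - u) * \<bar>Q$2 - R$2\<bar>)"
      using \<open>1 \<le> (1 - u) * \<bar>Q$2 - R$2\<bar>\<close> by (intro mult_left_mono) auto
    also have "\<dots> = sqrt 2 * ((1 - u) * \<bar>d\<bar>) * \<bar>Q$2 - R$2\<bar>"
      by simp
    also have "\<dots> \<le> \<bar>d\<bar>\<^sup>2 * \<bar>Q$2 - R$2\<bar>"
      using ineq by (intro mult_right_mono) auto
    also have "\<dots> = \<bar>d\<bar> * \<bar>cross2 P Q R\<bar>"
      unfolding cr by (simp add: power2_eq_square)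
    finally show ?thesis
      using \<open>d \<noteq> 0\<close> by simp
  next
    case 2
    define e where "e = R$1 - P$1"
    have QR: "Q$1 = P$1 - e" "R$1 = P$1 + e"
      using 2 by (auto simp: e_def)
    have "P$1 - \<bar>e\<bar> \<le> 0"
      by (rule left; insert QR; linarith)
    moreover have "1 \<le> P$1 + \<bar>e\<bar>"
      by (rule right; insert QR; linarith)
    ultimately have bnd: "P$1 \<le> \<bar>e\<bar>" "1 - P$1 \<le> \<bar>e\<bar>"
      by auto
    then have "e \<noteq> 0"
      by auto
    \<comment> \<open>The abscissa is P$1 + (w - v) * e, so w - v is the same for both points. They
      differ by a shift along the median from \<open>P\<close>, which is vertical and has length S /
      2.\<close>
    have we: "(w - v) * e = t - P$1" "(w' - v') * e = t - P$1"
      using x unfolding P1 QR by (auto simp: algebra_simps)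
    then have ww: "w' - v' = w - v"
      using \<open>e \<noteq> 0\<close> by (metis mult_right_cancel)
    define S where "S = \<bar>Q$2 + R$2 - 2 * P$2\<bar>"
    have "v' - v = w' - w"
      using ww by simp
    then have "(w' - w) * (Q$2 + R$2 - 2 * P$2) = 1"
      using y P1 by algebra
    then have prod: "\<bar>w' - w\<bar> * S = 1"
      unfolding S_def by (simp flip: abs_mult)
    \<comment> \<open>Both v + w and v' + w' lie between |w - v| and 1, and they differ by 2 * |w' -
      w|.\<close>
    have "2 * \<bar>w' - w\<bar> \<le> 1 - \<bar>w - v\<bar>"
      using uvw uvw' ww by (smt (verit))
    then have "2 * \<bar>w' - w\<bar> * S \<le> (1 - \<bar>w - v\<bar>) * S"
      by (intro mult_right_mono) (auto simp: S_def)
    then have le: "2 \<le> (1 - \<bar>w - v\<bar>) * S"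
      using prod by simp
    have cr: "\<bar>cross2 P Q R\<bar> = \<bar>e\<bar> * S"
    proof -
      have "cross2 P Q R = - e * (Q$2 + R$2 - 2 * P$2)"
        by (simp add: cross2_def QR algebra_simps)
      then show ?thesis by (simp add: S_def abs_mult)
    qed
    have abs_we: "\<bar>w - v\<bar> * \<bar>e\<bar> = \<bar>t - P$1\<bar>"
      using we(1) by (simp flip: abs_mult)
    have ineq: "t * (\<bar>e\<bar> - \<bar>t - P$1\<bar>) \<le> \<bar>e\<bar>\<^sup>2"
    proof (cases "P$1 \<le> t")
      case True
      define f where "f = t - P$1"
      have f: "0 \<le> f" "t - f \<le> \<bar>e\<bar>"
        using True bnd by (auto simp: f_def)
      have "t * (\<bar>e\<bar> - f) \<le> \<bar>e\<bar>\<^sup>2"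
      \<comment> \<open>As a quadratic in |e|, the inequality has discriminant t^2 - 4 * t * f. When
        this is positive, |e| >= t - f >= f makes the product below nonnegative.\<close>
      proof (cases "t \<le> 4 * f")
        case True
        then have "t * t \<le> 4 * f * t"
          using t by (intro mult_right_mono) auto
        then show ?thesis
          using zero_le_power2[of "2 * \<bar>e\<bar> - t"] by (simp add: power2_eq_square algebra_simps)
      next
        case False
        then have "0 \<le> (\<bar>e\<bar> - (t - f)) * (\<bar>e\<bar> - f)"
          using f by (intro mult_nonneg_nonneg) auto
        then have "t * (\<bar>e\<bar> - f) + f * f \<le> \<bar>e\<bar>\<^sup>2"
          by (simp add: power2_eq_square algebra_simps)
        moreover have "0 \<le> f * f"
          by simp
        ultimately show ?thesis
          by linarith
      qed
      then show ?thesis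
        using True by (simp add: f_def)
    next
      case False
      then have "t * (\<bar>e\<bar> - \<bar>t - P$1\<bar>) \<le> t * \<bar>e\<bar>"
        using t by (intro mult_left_mono) auto
      also have "\<dots> \<le> \<bar>e\<bar> * \<bar>e\<bar>"
        using False bnd by (intro mult_right_mono) auto
      finally show ?thesis
        by (simp add: power2_eq_square)
    qed
    have "sqrt 2 * \<bar>e\<bar> * 2 \<le> sqrt 2 * \<bar>e\<bar> * ((1 - \<bar>w - v\<bar>) * S)"
      using le by (intro mult_left_mono) auto
    also have "\<dots> = 2 * (t * (\<bar>e\<bar> - \<bar>w - v\<bar> * \<bar>e\<bar>)) * S"
      unfolding t(5) by (simp add: algebra_simps)
    also have "\<dots> \<le> 2 * \<bar>e\<bar>\<^sup>2 * S"
      unfolding abs_we using ineq by (intro mult_right_mono mult_left_mono) (auto simp: S_def)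
    also have "\<dots> = \<bar>e\<bar> * \<bar>cross2 P Q R\<bar> * 2"
      unfolding cr by (simp add: power2_eq_square)
    finally show ?thesis
      using \<open>e \<noteq> 0\<close> by simp
  qed
qed

text \<open>Stretching replaces the thin triangle by a fixed one; the thinness survives only as the
  weight h^2 in the equation for equal sides.\<close>

lemma normalized_container:
  fixes h t k :: real
  assumes h: "0 < h"
    and cont: "\<forall>T. is_triangle T \<and> area T = 1 \<longrightarrow> (\<exists>T'. isosceles_container T T' \<and> area T' < k)"
  shows "\<exists>P Q R. {pt 0 0, pt 1 0, pt t 1} \<subseteq> convex hull {P, Q, R} \<and> \<bar>cross2 P Q R\<bar> < k \<and>
    (P$1 - Q$1)\<^sup>2 + h\<^sup>2 * (P$2 - Q$2)\<^sup>2 = (P$1 - R$1)\<^sup>2 + h\<^sup>2 * (P$2 - R$2)\<^sup>2"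
proof -
  \<comment> \<open>s^2 * h = 2 gives \<open>T\<close> area 1 and also makes |cross2| of the
    stretched vertices equal to the area of \<open>T'\<close>.\<close>
  define s where "s = sqrt (2 / h)"
  have s: "0 < s" "s * s * h = 2"
    using h by (auto simp: s_def)
  define f :: "point \<Rightarrow> point" where "f = (\<lambda>X. pt (X$1 / s) (X$2 / (s * h)))"
  have f: "linear f"
    by (intro linearI) (auto simp: f_def vec_eq_iff forall_2 add_divide_distrib)
  define T where "T = convex hull {pt 0 0, pt s 0, pt (s * t) (s * h)}"
  have T: "area T = 1"
    using s h by (simp add: T_def area_triangle cross2_def)
  then have "is_triangle T"
    unfolding is_triangle_def triangle_with_vertices_def
    by (metis T_def collinear_iff_area_zero zero_neq_one)
  with T cont obtain T' where T': "isosceles_container T T'" "area T' < k"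
    by blast
  then obtain P Q R where PQR: "T' = convex hull {P, Q, R}" "dist P Q = dist P R" "T \<subseteq> T'"
    by (auto simp: isosceles_container_def isosceles_def triangle_with_vertices_def)
  have "f ` {pt 0 0, pt s 0, pt (s * t) (s * h)} \<subseteq> f ` T'"
    using PQR(3) by (intro image_mono) (auto simp: T_def hull_inc)
  moreover have "f ` {pt 0 0, pt s 0, pt (s * t) (s * h)} = {pt 0 0, pt 1 0, pt t 1}"
    using s h by (simp add: f_def)
  moreover have "f ` T' = convex hull {f P, f Q, f R}"
    using convex_hull_linear_image[OF f, of "{P, Q, R}"] by (simp add: PQR(1))
  ultimately have "{pt 0 0, pt 1 0, pt t 1} \<subseteq> convex hull {f P, f Q, f R}"
    by metis
  moreover have "\<bar>cross2 (f P) (f Q) (f R)\<bar> < k"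
  proof -
    have "cross2 (f P) (f Q) (f R) = cross2 P Q R / (s * s * h)"
      by (simp add: cross2_def f_def diff_divide_distrib add_divide_distrib algebra_simps)
    then show ?thesis
      using T'(2) unfolding PQR(1) area_triangle s(2) by simp
  qed
  moreover have "((f P)$1 - (f X)$1)\<^sup>2 + h\<^sup>2 * ((f P)$2 - (f X)$2)\<^sup>2 = (dist P X)\<^sup>2 / s\<^sup>2" for X
    using s(1) h unfolding dist_sq_plane f_def
    by (simp add: power_divide power_mult_distrib add_divide_distrib flip: diff_divide_distrib)
  ultimately show ?thesis
    using PQR(2) by metis
qed

text \<open>Together with each of two sides of the fixed triangle, a vertex \<open>X\<close> spans a
  triangle inside the container. The area bounds keep \<open>X\<close> close to two nonparallel
  lines.\<close>

lemma container_vertex_bounded: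
  fixes P Q R :: point and t :: real
  assumes "{pt 0 0, pt 1 0, pt t 1} \<subseteq> convex hull {P, Q, R}" and "\<bar>cross2 P Q R\<bar> < k"
    and "X \<in> {P, Q, R}" and t: "0 \<le> t" "t \<le> 1"
  shows "norm X \<le> 3 * k"
proof -
  have "X \<in> convex hull {P, Q, R}"
    using assms(3) by (rule hull_inc)
  then have "\<bar>cross2 X (pt 0 0) (pt 1 0)\<bar> < k" "\<bar>cross2 X (pt 0 0) (pt t 1)\<bar> < k"
    using assms(1,2) cross2_mono[of X "pt 0 0" "pt 1 0" P Q R]
      cross2_mono[of X "pt 0 0" "pt t 1" P Q R] by auto
  then have "\<bar>X$2\<bar> < k" "\<bar>t * X$2 - X$1\<bar> < k"
    by (simp_all add: cross2_def algebra_simps)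
  moreover have "\<bar>t * X$2\<bar> \<le> \<bar>X$2\<bar>"
    using t by (simp add: abs_mult mult_left_le_one_le)
  moreover have "norm X \<le> \<bar>X$1\<bar> + \<bar>X$2\<bar>"
    using norm_le_l1_cart[of X] by (simp add: sum_2)
  ultimately show ?thesis
    by linarith
qed

lemma sqrt_2_optimal:
  assumes "k < sqrt 2"
  shows "\<not> (\<forall>T. is_triangle T \<and> area T = 1 \<longrightarrow> (\<exists>T'. isosceles_container T T' \<and> area T' < k))"
proof
  assume cont: "\<forall>T. is_triangle T \<and> area T = 1 \<longrightarrow> (\<exists>T'. isosceles_container T T' \<and> area T' < k)"
  define t :: real where "t = 1 / sqrt 2"
  define h where "h n = inverse (real (Suc n))" for n
  have "\<forall>n. \<exists>P Q R. {pt 0 0, pt 1 0, pt t 1} \<subseteq> convex hull {P, Q, R} \<and> \<bar>cross2 P Q R\<bar> < k \<and>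
    (P$1 - Q$1)\<^sup>2 + (h n)\<^sup>2 * (P$2 - Q$2)\<^sup>2 = (P$1 - R$1)\<^sup>2 + (h n)\<^sup>2 * (P$2 - R$2)\<^sup>2"
    using normalized_container[OF _ cont] by (simp add: h_def)
  then obtain P Q R where
    sub: "\<And>n. {pt 0 0, pt 1 0, pt t 1} \<subseteq> convex hull {P n, Q n, R n}" and
    cr: "\<And>n. \<bar>cross2 (P n) (Q n) (R n)\<bar> < k" and
    iso: "\<And>n. (P n$1 - Q n$1)\<^sup>2 + (h n)\<^sup>2 * (P n$2 - Q n$2)\<^sup>2 =
      (P n$1 - R n$1)\<^sup>2 + (h n)\<^sup>2 * (P n$2 - R n$2)\<^sup>2"
    by metis
  \<comment> \<open>Bundling the vertices in a product space yields one subsequence along which all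
    three converge.\<close>
  define z where "z n = (P n, Q n, R n)" for n
  have bound: "norm X \<le> 3 * k" if "X \<in> {P n, Q n, R n}" for X n
    using container_vertex_bounded[OF sub cr that] by (simp add: t_def)
  have "range z \<subseteq> cball 0 (3 * k) \<times> cball 0 (3 * k) \<times> cball 0 (3 * k)"
  proof (rule image_subsetI)
    show "z n \<in> cball 0 (3 * k) \<times> cball 0 (3 * k) \<times> cball 0 (3 * k)" for n
      using bound[of "P n" n] bound[of "Q n" n] bound[of "R n" n] by (simp add: z_def)
  qed
  then have "bounded (range z)"
    by (rule bounded_subset[rotated]) (intro bounded_Times bounded_cball)
  then obtain l r where r: "strict_mono r" and lim: "(z \<circ> r) \<longlonglongrightarrow> l"
    using bounded_imp_convergent_subsequence by blast
  obtain p q q' where l: "l = (p, q, q')"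
    by (cases l)
  have P: "(\<lambda>n. P (r n)) \<longlonglongrightarrow> p" and Q: "(\<lambda>n. Q (r n)) \<longlonglongrightarrow> q" and R: "(\<lambda>n. R (r n)) \<longlonglongrightarrow> q'"
    using tendsto_fst[OF lim] tendsto_fst[OF tendsto_snd[OF lim]] tendsto_snd[OF tendsto_snd[OF lim]]
    by (simp_all add: z_def l o_def)
  have h: "(\<lambda>n. h (r n)) \<longlonglongrightarrow> 0"
    using LIMSEQ_subseq_LIMSEQ[OF LIMSEQ_inverse_real_of_nat r] by (simp add: h_def o_def)
  have "x \<in> convex hull {p, q, q'}" if "x \<in> {pt 0 0, pt 1 0, pt t 1}" for x
    using sub that by (intro in_convex_hull_3_limit[OF P Q R]) blast
  then have sub': "{pt 0 0, pt 1 0, pt t 1} \<subseteq> convex hull {p, q, q'}"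
    by blast
  have iso_lim: "(\<lambda>n. (P (r n)$1 - U (r n)$1)\<^sup>2 + (h (r n))\<^sup>2 * (P (r n)$2 - U (r n)$2)\<^sup>2)
      \<longlonglongrightarrow> (p$1 - u$1)\<^sup>2 + 0\<^sup>2 * (p$2 - u$2)\<^sup>2" if "(\<lambda>n. U (r n)) \<longlonglongrightarrow> u" for U u
    by (intro tendsto_intros P h that)
  \<comment> \<open>The vertical terms carry the factor h^2 and vanish in the limit.\<close>
  have "(p$1 - q$1)\<^sup>2 = (p$1 - q'$1)\<^sup>2"
    using LIMSEQ_unique[OF iso_lim[OF Q] iso_lim[OF R, folded iso]] by simp
  then have "sqrt 2 \<le> \<bar>cross2 p q q'\<bar>"
    using limit_container_bound sub' by (simp add: t_def)
  moreover have "(\<lambda>n. \<bar>cross2 (P (r n)) (Q (r n)) (R (r n))\<bar>) \<longlonglongrightarrow> \<bar>cross2 p q q'\<bar>"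
    unfolding cross2_def by (intro tendsto_intros P Q R)
  \<comment> \<open>The limit keeps only a weak inequality, which suffices because k < sqrt 2 is
    strict.\<close>
  then have "\<bar>cross2 p q q'\<bar> \<le> k"
    by (rule Lim_bounded[of _ _ 0]) (use cr less_imp_le in blast)
  ultimately show False
    using assms by simp
qed

theorem theorem1p7:
  shows "(\<forall>T. is_triangle T \<and> area T = 1 \<longrightarrow>
            (\<exists>T'. isosceles_container T T' \<and> area T' < sqrt 2)) \<and>
         (\<forall>T. is_triangle T \<and> \<not> isosceles T \<and> area T = 1 \<longrightarrow>
            (\<exists>T'. special_container_first_kind T T' \<and> area T' < (1 + sqrt 5) / 2)) \<and>
         (\<forall>k < sqrt 2. \<not> (\<forall>T. is_triangle T \<and> area T = 1 \<longrightarrow>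
            (\<exists>T'. isosceles_container T T' \<and> area T' < k))) \<and>
         (\<forall>k < (1 + sqrt 5) / 2. \<not> (\<forall>T. is_triangle T \<and> \<not> isosceles T \<and> area T = 1 \<longrightarrow>
            (\<exists>T'. special_container_first_kind T T' \<and> area T' < k)))"
  using isosceles_container_area_less_sqrt_2 special_container_area_less_golden_ratio
    sqrt_2_optimal golden_ratio_optimal
  by (meson order_less_asym)

end
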